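(* Let $x_1,\ldots,x_p\in\mathbb{C}$ be distinct points and let, after renumbering, $x_1,\ldots,x_n$ be a corresponding reduced set. Let $\Psi(s)$ be an $m\times m$-valued polynomial in $\mathcal{GPE}$, not identically zero, with $\Psi(x_j)=0$ for $j=1,\ldots,p$, and of minimal degree among all such polynomials. Then there exists a positive semidefinite matrix $M\in\mathbb{C}^{m\times m}$ such that $$\Psi(s)=\prod_{j=1}^{n}(x_j-s)\,M\,(x_j^*+s)=\left(\prod_{j=1}^{n}(x_j-s)(x_j^*+s)\right)M .$$
   Context: For a complex number $x$, $x^*$ denotes the complex conjugate; for a matrix, $^*$ is the conjugate transpose. For $F:\mathbb{C}\to\mathbb{C}^{m\times m}$, $F^{\#}(s):=\left(F(-s^* )\right)^*$. An $m\times m$-valued polynomial $F(s)$ of the complex variable $s$ belongs to $\mathcal{GPE}$ (Generalized Positive Even) if $F^{\#}(s)=F(s)$ and $F(s)$ is (Hermitian) positive semidefinite for almost all $s\in i\mathbb{R}$. A reduced set of $x_1,\ldots,x_p$ is a maximal subset, renumbered $x_1,\ldots,x_n$, such that $x_j-x_k\neq 0$ and $x_j+x_k^*\neq0$ for all $1\le j<k\le n$. Degree means McMillan degree: for a matrix polynomial $F(s)=\sum_{k=0}^{q}C_ks^k$ it is the rank of the block upper triangular block Toeplitz matrix with $(q+1)\times(q+1)$ blocks of size $m\times m$ whose first block row is $(C_q,C_{q-1},\ldots,C_1,C_0)$, i.e. whose $(a,b)$ block is $C_{q-(b-a)}$ for $b\ge a$ and $0$ for $b<a$. *)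

theory Defs
  imports
    "HOL-Analysis.Analysis"
    "Jordan_Normal_Form.DL_Rank"
    "Jordan_Normal_Form.Schur_Decomposition"
begin

text \<open>An \<open>m \<times> m\<close>-valued polynomial is a matrix \<open>P \<in> carrier_mat m m\<close> with entries of type
  \<^typ>\<open>complex poly\<close>.\<close>

definition eval_mat :: "complex poly mat \<Rightarrow> complex \<Rightarrow> complex mat" where
  "eval_mat P s = map_mat (\<lambda>p. poly p s) P"

definition psd :: "nat \<Rightarrow> complex mat \<Rightarrow> bool" where
  "psd m A \<longleftrightarrow> A \<in> carrier_mat m m \<and> mat_adjoint A = A \<and>
     (\<forall>v \<in> carrier_vec m. 0 \<le> Re ((A *\<^sub>v v) \<bullet>c v))"

definition sharp :: "(complex \<Rightarrow> complex mat) \<Rightarrow> complex \<Rightarrow> complex mat" where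
  "sharp F s = mat_adjoint (F (- cnj s))"

text \<open>``Almost all'' \<open>s \<in> \<i>\<real>\<close> refers to Lebesgue measure on the imaginary axis.\<close>

definition GPE :: "nat \<Rightarrow> complex poly mat set" where
  "GPE m = {P \<in> carrier_mat m m.
     (\<forall>s. sharp (eval_mat P) s = eval_mat P s) \<and>
     (AE t in lborel. psd m (eval_mat P (\<i> * complex_of_real t)))}"

text \<open>The largest degree of an entry; \<open>0\<close> is inserted only to cover the matrix without entries.\<close>

definition poly_mat_degree :: "complex poly mat \<Rightarrow> nat" where
  "poly_mat_degree P = Max (insert 0 (degree ` elements_mat P))"

text \<open>With blocks indexed from \<open>0\<close>, the entry in row \<open>i\<close> and column \<open>j\<close> lies in the block
  \<open>(i div m, j div m)\<close>, at position \<open>(i mod m, j mod m)\<close> inside it.\<close>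

definition block_toeplitz :: "nat \<Rightarrow> nat \<Rightarrow> complex poly mat \<Rightarrow> complex mat" where
  "block_toeplitz m q P = mat ((q + 1) * m) ((q + 1) * m) (\<lambda>(i, j).
     let a = i div m; b = j div m in
     if a \<le> b then coeff (P $$ (i mod m, j mod m)) (q - (b - a)) else 0)"

text \<open>Padding \<open>P\<close> with zero leading coefficients does not change the rank below, so taking
  \<open>q\<close> to be the exact degree loses nothing.\<close>

definition mcmillan_degree :: "nat \<Rightarrow> complex poly mat \<Rightarrow> nat" where
  "mcmillan_degree m P = (let q = poly_mat_degree P in
     vec_space.rank ((q + 1) * m) (block_toeplitz m q P))"

definition nondegenerate :: "(nat \<Rightarrow> complex) \<Rightarrow> nat set \<Rightarrow> bool" where
  "nondegenerate x J \<longleftrightarrow>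
     (\<forall>j\<in>J. \<forall>k\<in>J. j < k \<longrightarrow> x j - x k \<noteq> 0 \<and> x j + cnj (x k) \<noteq> 0)"

definition reduced_indices :: "(nat \<Rightarrow> complex) \<Rightarrow> nat \<Rightarrow> nat set \<Rightarrow> bool" where
  "reduced_indices x p J \<longleftrightarrow> J \<subseteq> {1..p} \<and> nondegenerate x J \<and>
     (\<forall>J'. J \<subseteq> J' \<and> J' \<subseteq> {1..p} \<and> nondegenerate x J' \<longrightarrow> J' = J)"

definition nonzero_solutions :: "nat \<Rightarrow> (nat \<Rightarrow> complex) \<Rightarrow> nat \<Rightarrow> complex poly mat set" where
  "nonzero_solutions m x p =
     {P \<in> GPE m. P \<noteq> 0\<^sub>m m m \<and> (\<forall>j\<in>{1..p}. eval_mat P (x j) = 0\<^sub>m m m)}"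

end

theory Submission
  imports Defs "Jordan_Normal_Form.DL_Rank_Submatrix"
begin

text \<open>
  A scalar polynomial that is nonnegative on the imaginary axis and satisfies the reflection
  symmetry is divisible by \<open>(x - s)(x\<^sup>* + s)\<close> at each of its zeros \<open>x\<close>: off the axis
  because \<open>-x\<^sup>*\<close> is another zero, on the axis because a simple zero would be a change of sign.
  Applied to the quadratic forms \<open>v\<^sup>* \<Psi> v\<close> and polarized, this makes
  \<open>g = \<Prod>j (x\<^sub>j - s)(x\<^sub>j\<^sup>* + s)\<close> divide every entry of \<open>\<Psi>\<close>.
  For a nonzero \<open>P\<close> whose entries have maximal degree \<open>q\<close>, the block Toeplitz matrix contains a
  triangular minor of size \<open>q + 1\<close>, so \<open>P\<close> has McMillan degree at least \<open>q + 1\<close>,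
  while the rank one solution \<open>g E\<^sub>1\<^sub>1\<close> has McMillan degree at most \<open>deg g + 1\<close>.
  Minimality therefore leaves only constant quotients \<open>\<Psi> / g\<close>.
\<close>

section \<open>Scalar even polynomials that are nonnegative on the imaginary axis\<close>

lemma closed_cofinite_eq_UNIV:
  fixes S :: "'a::{real_normed_vector,perfect_space} set"
  assumes "closed S" "finite F" "- F \<subseteq> S"
  shows "S = UNIV"
proof -
  have "open (- S)" "finite (- S)"
    using assms finite_subset[of "- S" F] by auto
  then have "- S = {}"
    using finite_imp_not_open by blast
  then show ?thesis by blast
qed

text \<open>The case \<open>m = 1\<close> of \<open>GPE\<close>, but at every point of the axis
  instead of almost every one. The symmetry forces real values on the axis, so bounding
  \<open>Re\<close> is enough.\<close>

definition even_nonneg :: "complex poly \<Rightarrow> bool" where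
  "even_nonneg q \<longleftrightarrow> (\<forall>s. poly q (- cnj s) = cnj (poly q s)) \<and>
     (\<forall>t. 0 \<le> Re (poly q (\<i> * complex_of_real t)))"

text \<open>The sign of the first factor is chosen so that the product equals the squared distance
  from \<open>x\<close> on the imaginary axis.\<close>

definition zero_pair :: "complex \<Rightarrow> complex poly" where
  "zero_pair x = [:x, -1:] * [:cnj x, 1:]"

lemma poly_zero_pair: "poly (zero_pair x) s = (x - s) * (cnj x + s)"
  by (simp add: zero_pair_def algebra_simps)

lemma zero_pair_nonzero: "zero_pair x \<noteq> 0"
  by (simp add: zero_pair_def)

lemma poly_zero_pair_imaginary:
  "poly (zero_pair x) (\<i> * complex_of_real t)
     = complex_of_real ((cmod (x - \<i> * complex_of_real t))\<^sup>2)"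
  unfolding poly_zero_pair complex_norm_square by simp

lemma poly_zero_pair_reflect: "poly (zero_pair x) (- cnj s) = cnj (poly (zero_pair x) s)"
  by (simp add: poly_zero_pair algebra_simps)

text \<open>Dividing by \<open>t - a\<close> gives \<open>Re (k t)\<close> opposite weak signs on
  the two sides of \<open>a\<close> and makes \<open>Im (k t)\<close> vanish for
  \<open>t \<noteq> a\<close>; continuity carries all three facts to \<open>a\<close>.\<close>

lemma sign_change_imp_zero:
  fixes k :: "real \<Rightarrow> complex"
  assumes "continuous_on UNIV k"
    and im: "\<And>t. Im (complex_of_real (t - a) * k t) = 0"
    and re: "\<And>t. 0 \<le> Re (complex_of_real (t - a) * k t)"
  shows "k a = 0"
proof -
  have k: "isCont k a"
    using assms(1) by (simp add: continuous_on_eq_continuous_at)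
  have rk: "((\<lambda>t. Re (k t)) \<longlongrightarrow> Re (k a)) (at a)" and ik: "((\<lambda>t. Im (k t)) \<longlongrightarrow> Im (k a)) (at a)"
    using k by (auto simp: isCont_def intro: tendsto_intros)
  have "Re (k a) \<ge> 0"
  proof (rule tendsto_lowerbound[OF filterlim_mono[OF rk order_refl at_le[OF subset_UNIV]]])
    show "\<forall>\<^sub>F t in at_right a. 0 \<le> Re (k t)"
      using eventually_at_right_less[of a]
    proof eventually_elim
      case (elim t)
      then show ?case using re[of t] by (auto simp: zero_le_mult_iff)
    qed
  qed simp
  moreover have "Re (k a) \<le> 0"
  proof (rule tendsto_upperbound[OF filterlim_mono[OF rk order_refl at_le[OF subset_UNIV]]])
    have "\<forall>\<^sub>F t in at_left a. t < a"
      by (auto simp: eventually_at_filter)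
    then show "\<forall>\<^sub>F t in at_left a. Re (k t) \<le> 0"
    proof eventually_elim
      case (elim t)
      then show ?case using re[of t] by (auto simp: zero_le_mult_iff)
    qed
  qed simp
  moreover have "Im (k a) = 0"
  proof (rule tendsto_unique[OF _ ik])
    have "\<forall>t. t \<noteq> a \<longrightarrow> Im (k t) = 0"
      using im by auto
    then show "((\<lambda>t. Im (k t)) \<longlongrightarrow> 0) (at a)"
      by (intro tendsto_eventually) (simp add: eventually_at_filter)
  qed simp
  ultimately show ?thesis by (simp add: complex_eq_iff)
qed

text \<open>The quotient inherits \<open>even_nonneg\<close>, which allows iteration:
  \<open>zero_pair x\<close> has the same symmetry and is positive on the axis off its zeros, and
  those finitely many exceptions are filled in by continuity.\<close>

lemma even_nonneg_dvd_step:
  assumes q: "even_nonneg q" and x: "poly q x = 0"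
  shows "\<exists>r. q = zero_pair x * r \<and> even_nonneg r"
proof -
  have refl: "poly q (- cnj s) = cnj (poly q s)" for s
    using q by (simp add: even_nonneg_def)
  have pos: "0 \<le> Re (poly q (\<i> * complex_of_real t))" for t
    using q by (simp add: even_nonneg_def)
  obtain q1 where q1: "q = [:- x, 1:] * q1"
    using x by (auto simp: poly_eq_0_iff_dvd)
  have "poly q1 (- cnj x) = 0"
  proof (cases "x = - cnj x")
    case False
    moreover have "(- cnj x - x) * poly q1 (- cnj x) = 0"
      using refl[of x] x by (simp add: q1 algebra_simps)
    ultimately show ?thesis by (metis eq_iff_diff_eq_0 mult_eq_0_iff)
  next
    case True
    define a where "a = Im x"
    have xa: "x = \<i> * complex_of_real a"
      using arg_cong[OF True, of Re] by (simp add: a_def complex_eq_iff)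
    \<comment> \<open>On the axis \<open>s - x\<close> is \<open>\<i>\<close> times the real number
      \<open>t - a\<close>; the factor \<open>\<i>\<close> is moved into \<open>k\<close>.\<close>
    define k where "k t = \<i> * poly q1 (\<i> * complex_of_real t)" for t
    have qk: "poly q (\<i> * complex_of_real t) = complex_of_real (t - a) * k t" for t
      by (simp add: q1 k_def xa algebra_simps)
    have "k a = 0"
    proof (rule sign_change_imp_zero)
      show "continuous_on UNIV k" unfolding k_def by (intro continuous_intros)
      show "0 \<le> Re (complex_of_real (t - a) * k t)" for t
        using pos[of t] by (simp only: qk)
      show "Im (complex_of_real (t - a) * k t) = 0" for t
      proof -
        have "- cnj (\<i> * complex_of_real t) = \<i> * complex_of_real t" by simp
        then have "poly q (\<i> * complex_of_real t) = cnj (poly q (\<i> * complex_of_real t))"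
          using refl[of "\<i> * complex_of_real t"] by simp
        then show ?thesis unfolding qk by (simp add: complex_eq_iff)
      qed
    qed
    then show ?thesis by (simp add: k_def xa)
  qed
  then obtain q2 where q2: "q1 = [:cnj x, 1:] * q2"
    by (auto simp: poly_eq_0_iff_dvd)
  \<comment> \<open>The minus sign turns the factor \<open>s - x\<close> into the
    \<open>x - s\<close> of \<open>zero_pair\<close>.\<close>
  define r where "r = - q2"
  have qr: "q = zero_pair x * r"
  proof -
    have "[:x, -1:] = - [:- x, 1:]" by simp
    then show ?thesis
      unfolding q1 q2 zero_pair_def r_def by (simp only: mult.assoc minus_mult_minus mult_minus_right mult_minus_left minus_minus)
  qed
  let ?F = "{s. poly (zero_pair x) s = 0}"
  have fin: "finite ?F" by (rule poly_roots_finite[OF zero_pair_nonzero])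
  have "{s. poly r (- cnj s) = cnj (poly r s)} = UNIV"
  proof (rule closed_cofinite_eq_UNIV[OF _ fin])
    show "closed {s. poly r (- cnj s) = cnj (poly r s)}"
      by (intro closed_Collect_eq continuous_intros)
    show "- ?F \<subseteq> {s. poly r (- cnj s) = cnj (poly r s)}"
      using refl by (auto simp: qr poly_zero_pair_reflect)
  qed
  moreover have "{t. 0 \<le> Re (poly r (\<i> * complex_of_real t))} = UNIV"
  proof (rule closed_cofinite_eq_UNIV)
    show "closed {t. 0 \<le> Re (poly r (\<i> * complex_of_real t))}"
      by (intro closed_Collect_le continuous_intros)
    show "finite ((\<lambda>t. \<i> * complex_of_real t) -` ?F)"
      by (rule finite_vimageI[OF fin]) (auto simp: inj_on_def)
    show "- ((\<lambda>t. \<i> * complex_of_real t) -` ?F) \<subseteq> {t. 0 \<le> Re (poly r (\<i> * complex_of_real t))}"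
    proof
      fix t assume "t \<in> - ((\<lambda>t. \<i> * complex_of_real t) -` ?F)"
      then have "(cmod (x - \<i> * complex_of_real t))\<^sup>2 > 0"
        by (auto simp: poly_zero_pair_imaginary)
      then show "t \<in> {t. 0 \<le> Re (poly r (\<i> * complex_of_real t))}"
        using pos[of t] unfolding qr poly_mult poly_zero_pair_imaginary
        by (auto simp: zero_le_mult_iff)
    qed
  qed
  ultimately have "even_nonneg r"
    unfolding even_nonneg_def by blast
  with qr show ?thesis by blast
qed

text \<open>Nondegeneracy says that the factors already split off do not vanish at the next point,
  so the remaining quotient does and another pair can be split off.\<close>

lemma even_nonneg_dvd:
  assumes "even_nonneg q" "nondegenerate x {1..n}" "\<And>j. j \<in> {1..n} \<Longrightarrow> poly q (x j) = 0"
  shows "\<exists>r. q = (\<Prod>j=1..n. zero_pair (x j)) * r \<and> even_nonneg r"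
  using assms(2,3)
proof (induction n)
  case 0
  then show ?case using assms(1) by simp
next
  case (Suc n)
  have "nondegenerate x {1..n}"
    using Suc.prems(1) by (auto simp: nondegenerate_def)
  then obtain r where r: "q = (\<Prod>j=1..n. zero_pair (x j)) * r" "even_nonneg r"
    using Suc by auto
  have "poly (zero_pair (x j)) (x (Suc n)) \<noteq> 0" if "j \<in> {1..n}" for j
  proof -
    have "x j - x (Suc n) \<noteq> 0" "x j + cnj (x (Suc n)) \<noteq> 0"
      using Suc.prems(1) that by (auto simp: nondegenerate_def)
    moreover have "cnj (x j) + x (Suc n) = cnj (x j + cnj (x (Suc n)))" by simp
    ultimately show ?thesis
      unfolding poly_zero_pair by (metis complex_cnj_zero_iff mult_eq_0_iff)
  qed
  moreover have "poly q (x (Suc n)) = 0"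
    using Suc.prems(2) by simp
  ultimately have "poly r (x (Suc n)) = 0"
    by (auto simp: r(1) poly_prod)
  then obtain r' where "r = zero_pair (x (Suc n)) * r'" "even_nonneg r'"
    using even_nonneg_dvd_step[OF r(2)] by blast
  then show ?case
    using r(1) by (intro exI[of _ r']) (simp add: mult.assoc)
qed

section \<open>Quadratic forms of polynomial matrices and polarization\<close>

text \<open>This is \<open>v* P v\<close> for a constant vector \<open>v\<close>, given as a
  function so that test vectors carry no dimension conditions.\<close>

definition qform :: "nat \<Rightarrow> complex poly mat \<Rightarrow> (nat \<Rightarrow> complex) \<Rightarrow> complex poly" where
  "qform m P v = (\<Sum>i<m. \<Sum>j<m. Polynomial.smult (cnj (v i) * v j) (P $$ (i, j)))"

lemma mat_quadratic_form:
  assumes "A \<in> carrier_mat m m"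
  shows "(A *\<^sub>v vec m v) \<bullet>c vec m v = (\<Sum>i<m. \<Sum>j<m. cnj (v i) * v j * A $$ (i, j))"
  using assms
  by (auto simp: scalar_prod_def sum_distrib_left sum_distrib_right atLeast0LessThan ac_simps intro!: sum.cong)

lemma poly_qform:
  assumes "P \<in> carrier_mat m m"
  shows "poly (qform m P v) s = (eval_mat P s *\<^sub>v vec m v) \<bullet>c vec m v"
  using assms by (subst mat_quadratic_form) (auto simp: qform_def eval_mat_def poly_sum intro!: sum.cong)

lemma index_mat_adjoint:
  "i < dim_col A \<Longrightarrow> j < dim_row A \<Longrightarrow> mat_adjoint A $$ (i, j) = conjugate (A $$ (j, i))"
  unfolding mat_adjoint_def by (simp add: mat_of_rows_index)

lemma dim_mat_adjoint [simp]: "dim_row (mat_adjoint A) = dim_col A" "dim_col (mat_adjoint A) = dim_row A"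
  unfolding mat_adjoint_def by auto

text \<open>The test vector is \<open>e_a + c e_b\<close>. Adding two conditionals keeps the formula
  valid for \<open>a = b\<close>, the case that yields the diagonal.\<close>

lemma qform_pair:
  assumes "a < m" "b < m"
  shows "qform m P (\<lambda>i. (if i = a then 1 else 0) + (if i = b then c else 0))
    = P $$ (a, a) + Polynomial.smult (c * cnj c) (P $$ (b, b)) + Polynomial.smult c (P $$ (a, b)) + Polynomial.smult (cnj c) (P $$ (b, a))"
proof -
  have *: "Polynomial.smult (cnj ((if i = a then 1 else 0) + (if i = b then c else 0)) *
      ((if j = a then 1 else 0) + (if j = b then c else 0))) (P $$ (i, j)) =
     (if i = a then (if j = a then P $$ (i, j) else 0) + (if j = b then Polynomial.smult c (P $$ (i, j)) else 0) else 0) +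
     (if i = b then (if j = a then Polynomial.smult (cnj c) (P $$ (i, j)) else 0)
        + (if j = b then Polynomial.smult (c * cnj c) (P $$ (i, j)) else 0) else 0)" for i j
    by (auto simp: smult_add_left algebra_simps)
  have d: "(\<Sum>j<m. if i = k then h j else 0) = (if i = k then \<Sum>j<m. h j else 0)"
    for i k :: nat and h :: "nat \<Rightarrow> complex poly"
    by simp
  show ?thesis
    unfolding qform_def * sum.distrib d using assms by (simp add: sum.distrib)
qed

text \<open>Coefficient \<open>c = 0\<close> gives the diagonal entries, \<open>c = 1\<close> the
  sum of the entries at \<open>(a, b)\<close> and \<open>(b, a)\<close>, and \<open>c = \<i>\<close>
  their difference up to a unit. Sum and difference add up to twice the entry at
  \<open>(a, b)\<close>.\<close>

lemma polarization_dvd: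
  assumes dvd: "\<And>v. g dvd qform m P v" and "a < m" "b < m"
  shows "g dvd P $$ (a, b)"
proof -
  have diag: "g dvd P $$ (i, i)" if "i < m" for i
    using dvd[of "\<lambda>k. (if k = i then 1 else 0) + (if k = i then 0 else 0)"] qform_pair[OF that that, of P 0] by simp
  have "g dvd P $$ (a, a) + P $$ (b, b) + (P $$ (a, b) + P $$ (b, a))"
    using dvd qform_pair[OF assms(2,3), of P 1] by (metis (no_types, lifting) add.assoc complex_cnj_one mult_1 smult_1_left)
  then have s: "g dvd P $$ (a, b) + P $$ (b, a)"
    using diag assms(2,3) by (meson dvd_add dvd_add_right_iff)
  have "g dvd P $$ (a, a) + P $$ (b, b) + Polynomial.smult \<i> (P $$ (a, b) - P $$ (b, a))"
    using dvd[of "\<lambda>i. (if i = a then 1 else 0) + (if i = b then \<i> else 0)"] qform_pair[OF assms(2,3), of P \<i>]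
    by (simp add: smult_diff_right algebra_simps)
  then have "g dvd Polynomial.smult \<i> (P $$ (a, b) - P $$ (b, a))"
    using diag assms(2,3) by (meson dvd_add dvd_add_right_iff)
  then have "g dvd P $$ (a, b) - P $$ (b, a)"
    by (simp add: dvd_smult_iff)
  from dvd_add[OF s this] have "g dvd P $$ (a, b) + P $$ (a, b)" by simp
  then have "g dvd Polynomial.smult (1 + 1) (P $$ (a, b))"
    unfolding smult_add_left by simp
  then show ?thesis by (subst (asm) dvd_smult_iff) simp_all
qed

section \<open>Rank bounds from triangular minors and from zero columns\<close>

lemma pick_image_strict_mono:
  assumes "strict_mono f" "k < N"
  shows "pick (f ` {..<N}) k = f k"
proof -
  have "{a \<in> f ` {..<N}. a < f k} = f ` {..<k}"
    using assms by (auto simp: strict_mono_less)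
  then have "card {a \<in> f ` {..<N}. a < f k} = k"
    using assms(1) by (simp add: card_image strict_mono_imp_inj_on)
  then show ?thesis
    using pick_card_in_set[of "f k" "f ` {..<N}"] assms(2) by simp
qed

text \<open>The submatrix on the chosen rows and columns is upper triangular with nonzero diagonal,
  so it is a nonvanishing minor. Strict monotonicity makes its internal order agree with
  \<open>r\<close> and \<open>c\<close>.\<close>

lemma (in vec_space) rank_ge_triangular_minor:
  assumes A: "A \<in> carrier_mat n nc" and r: "strict_mono r" and c: "strict_mono c"
    and bounds: "\<And>k. k < N \<Longrightarrow> r k < n \<and> c k < nc"
    and diag: "\<And>k. k < N \<Longrightarrow> A $$ (r k, c k) \<noteq> 0"
    and lower: "\<And>k l. l < k \<Longrightarrow> k < N \<Longrightarrow> A $$ (r k, c l) = 0"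
  shows "N \<le> rank A"
proof -
  define I where "I = r ` {..<N}"
  define J where "J = c ` {..<N}"
  have I: "{i. i < n \<and> i \<in> I} = I" and J: "{j. j < nc \<and> j \<in> J} = J"
    using bounds by (auto simp: I_def J_def)
  have cardI: "card I = N" and cardJ: "card J = N"
    using r c by (auto simp: I_def J_def card_image strict_mono_imp_inj_on)
  let ?B = "submatrix A I J"
  have B: "?B \<in> carrier_mat N N"
    using A by (intro carrier_matI) (auto simp: dim_submatrix I J cardI cardJ)
  have entry: "?B $$ (k, l) = A $$ (r k, c l)" if "k < N" "l < N" for k l
  proof -
    have "?B $$ (k, l) = A $$ (pick I k, pick J l)"
      using A that by (intro submatrix_index) (auto simp: I J cardI cardJ)
    then show ?thesis
      using that r c by (simp add: I_def J_def pick_image_strict_mono)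
  qed
  have "upper_triangular ?B"
    using B lower by (auto simp: upper_triangular_def entry)
  then have "det ?B = prod_list (diag_mat ?B)"
    using B by (rule det_upper_triangular)
  moreover have "0 \<notin> set (diag_mat ?B)"
    using B diag by (auto simp: diag_mat_def entry)
  ultimately have "det ?B \<noteq> 0"
    by (simp add: prod_list_zero_iff)
  from rank_gt_minor[OF A this] show ?thesis
    by (simp add: J cardJ)
qed

text \<open>The rank is the size of a maximal independent set of columns; such a set omits the zero
  vector, so its members are columns indexed by \<open>J\<close>.\<close>

lemma (in vec_space) rank_le_card_nonzero_cols:
  assumes A: "A \<in> carrier_mat n nc" and "finite J"
    and zero: "\<And>j. j < nc \<Longrightarrow> j \<notin> J \<Longrightarrow> col A j = 0\<^sub>v n"
  shows "rank A \<le> card J"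
proof -
  have "lin_indpt {}"
    by (simp add: finite_lin_indpt2)
  then obtain S where S: "maximal S (\<lambda>T. T \<subseteq> set (cols A) \<and> lin_indpt T)"
    using maximal_exists_superset[of "set (cols A)" "\<lambda>T. T \<subseteq> set (cols A) \<and> lin_indpt T" "{}"]
    by auto
  then have sub: "S \<subseteq> set (cols A)" and indpt: "lin_indpt S"
    by (auto simp: maximal_def)
  have "S \<subseteq> carrier_vec n"
    using sub cols_dim A by blast
  then have "0\<^sub>v n \<notin> S"
    using vs_zero_lin_dep[of S] indpt by (simp add: module_vec_def)
  have "S \<subseteq> col A ` J"
  proof
    fix u assume "u \<in> S"
    then obtain j where "j < nc" "u = col A j"
      using sub A by (auto simp: cols_def)
    with zero show "u \<in> col A ` J"
      using \<open>u \<in> S\<close> \<open>0\<^sub>v n \<notin> S\<close> by (cases "j \<in> J") auto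
  qed
  then have "card S \<le> card J"
    using \<open>finite J\<close> by (meson surj_card_le)
  then show ?thesis
    using rank_card_indpt[OF A S] by simp
qed

section \<open>Bounds on the McMillan degree\<close>

lemma block_index_less:
  fixes k m N i :: nat
  assumes "k < N" "i < m"
  shows "k * m + i < N * m"
proof -
  have "k * m + i < Suc k * m" using assms(2) by simp
  also have "\<dots> \<le> N * m" using assms(1) by (intro mult_le_mono1) simp
  finally show ?thesis .
qed

lemma index_block_toeplitz:
  assumes "a \<le> q" "b \<le> q" "i < m" "j < m"
  shows "block_toeplitz m q P $$ (a * m + i, b * m + j)
    = (if a \<le> b then coeff (P $$ (i, j)) (q - (b - a)) else 0)"
proof -
  have "a * m + i < (q + 1) * m" "b * m + j < (q + 1) * m"
    using assms block_index_less[of a "q + 1" i m] block_index_less[of b "q + 1" j m] by auto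
  then show ?thesis
    using assms by (simp add: block_toeplitz_def Let_def)
qed

lemma carrier_block_toeplitz: "block_toeplitz m q P \<in> carrier_mat ((q + 1) * m) ((q + 1) * m)"
  by (simp add: block_toeplitz_def)

lemma finite_elements_mat: "finite (elements_mat P)"
  by (simp add: elements_mat_def)

lemma degree_le_poly_mat_degree:
  assumes "P \<in> carrier_mat m m" "i < m" "j < m"
  shows "degree (P $$ (i, j)) \<le> poly_mat_degree P"
  unfolding poly_mat_degree_def using assms
  by (intro Max_ge) (auto simp: finite_elements_mat)

text \<open>The entry must be nonzero for its leading coefficient to be usable. If the maximum is
  \<open>0\<close>, possibly only the inserted default, any nonzero entry serves; otherwise a
  maximizing entry is nonzero because \<open>degree 0 = 0\<close>.\<close>

lemma poly_mat_degree_attained: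
  assumes P: "P \<in> carrier_mat m m" and "P \<noteq> 0\<^sub>m m m"
  obtains i j where "i < m" "j < m" "P $$ (i, j) \<noteq> 0" "degree (P $$ (i, j)) = poly_mat_degree P"
proof -
  obtain i j where ij: "i < m" "j < m" "P $$ (i, j) \<noteq> 0"
    using assms by (metis carrier_matD eq_matI index_zero_mat)
  have "poly_mat_degree P \<in> insert 0 (degree ` elements_mat P)"
    unfolding poly_mat_degree_def by (intro Max_in) (auto simp: finite_elements_mat)
  then consider "poly_mat_degree P = 0"
    | "poly_mat_degree P \<noteq> 0" "poly_mat_degree P \<in> degree ` elements_mat P" by auto
  then show ?thesis
  proof cases
    case 1
    then show ?thesis
      using that[OF ij] degree_le_poly_mat_degree[OF P ij(1,2)] by simp
  next
    case 2
    then obtain k l where "k < m" "l < m" "degree (P $$ (k, l)) = poly_mat_degree P"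
      using P by (auto dest!: elements_matD)
    then show ?thesis using that 2(1) by (metis degree_0)
  qed
qed

text \<open>Taking position \<open>(i, j)\<close> of every block, where that entry has maximal
  degree \<open>q\<close>, gives an upper triangular matrix of size \<open>q + 1\<close> with its
  leading coefficient along the diagonal.\<close>

lemma poly_mat_degree_less_mcmillan_degree:
  assumes P: "P \<in> carrier_mat m m" and "P \<noteq> 0\<^sub>m m m"
  shows "poly_mat_degree P < mcmillan_degree m P"
proof -
  define q where "q = poly_mat_degree P"
  obtain i j where ij: "i < m" "j < m" "P $$ (i, j) \<noteq> 0" "degree (P $$ (i, j)) = q"
    using poly_mat_degree_attained[OF assms] unfolding q_def by metis
  have mono: "strict_mono (\<lambda>k. k * m + l)" for l
    using ij by (auto simp: strict_mono_def)
  have "q + 1 \<le> vec_space.rank ((q + 1) * m) (block_toeplitz m q P)"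
  proof (rule vec_space.rank_ge_triangular_minor[OF carrier_block_toeplitz mono mono])
    show "k * m + i < (q + 1) * m \<and> k * m + j < (q + 1) * m" if "k < q + 1" for k
      using block_index_less[OF that ij(1)] block_index_less[OF that ij(2)] by blast
    show "block_toeplitz m q P $$ (k * m + i, k * m + j) \<noteq> 0" if "k < q + 1" for k
      using ij that by (subst index_block_toeplitz) auto
    show "block_toeplitz m q P $$ (k * m + i, l * m + j) = 0" if "l < k" "k < q + 1" for k l
      using ij that by (subst index_block_toeplitz) auto
  qed
  then show ?thesis unfolding mcmillan_degree_def Let_def q_def[symmetric] by linarith
qed

definition corner_mat :: "nat \<Rightarrow> complex poly \<Rightarrow> complex poly mat" where
  "corner_mat m g = mat m m (\<lambda>(i, j). if i = 0 \<and> j = 0 then g else 0)"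

lemma poly_mat_degree_corner_mat:
  assumes "0 < m"
  shows "poly_mat_degree (corner_mat m g) = degree g"
  unfolding poly_mat_degree_def
proof (rule Max_eqI)
  show "finite (insert 0 (degree ` elements_mat (corner_mat m g)))"
    by (simp add: finite_elements_mat)
  show "d \<le> degree g" if "d \<in> insert 0 (degree ` elements_mat (corner_mat m g))" for d
    using that by (auto dest!: elements_matD simp: corner_mat_def)
  have "g \<in> elements_mat (corner_mat m g)"
    using assms by (intro elements_matI[of _ m m 0 0]) (auto simp: corner_mat_def)
  then show "degree g \<in> insert 0 (degree ` elements_mat (corner_mat m g))"
    by blast
qed

text \<open>Only the first column of each of the \<open>degree g + 1\<close> block columns can be
  nonzero.\<close>

lemma mcmillan_degree_corner_mat:
  assumes "0 < m"
  shows "mcmillan_degree m (corner_mat m g) \<le> degree g + 1"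
proof -
  let ?q = "degree g" and ?J = "(\<lambda>k. k * m) ` {..degree g}"
  let ?T = "block_toeplitz m ?q (corner_mat m g)"
  have "vec_space.rank ((?q + 1) * m) ?T \<le> card ?J"
  proof (rule vec_space.rank_le_card_nonzero_cols[OF carrier_block_toeplitz])
    fix j assume j: "j < (?q + 1) * m" "j \<notin> ?J"
    have "j div m \<le> ?q"
      using j(1) by (metis add.commute less_Suc_eq_le less_mult_imp_div_less plus_1_eq_Suc)
    then have "j mod m \<noteq> 0"
      using j(2) by (metis atMost_iff div_mult_mod_eq add.right_neutral image_eqI)
    then show "col ?T j = 0\<^sub>v ((?q + 1) * m)"
      using j(1) assms by (intro eq_vecI) (auto simp: block_toeplitz_def corner_mat_def Let_def)
  qed simp
  also have "card ?J \<le> ?q + 1"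
    using card_image_le[of "{..degree g}" "\<lambda>k. k * m"] by simp
  finally show ?thesis
    unfolding mcmillan_degree_def Let_def poly_mat_degree_corner_mat[OF assms] .
qed

section \<open>Positive semidefiniteness and \<open>GPE\<close> in coordinates\<close>

lemma psd_iff:
  "psd m A \<longleftrightarrow> A \<in> carrier_mat m m \<and> (\<forall>i<m. \<forall>j<m. cnj (A $$ (j, i)) = A $$ (i, j)) \<and>
     (\<forall>v. 0 \<le> Re (\<Sum>i<m. \<Sum>j<m. cnj (v i) * v j * A $$ (i, j)))"
proof (cases "A \<in> carrier_mat m m")
  case True
  have "mat_adjoint A = A \<longleftrightarrow> (\<forall>i<m. \<forall>j<m. cnj (A $$ (j, i)) = A $$ (i, j))"
    using True by (subst mat_eq_iff) (auto simp: index_mat_adjoint)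
  moreover have "(\<forall>v \<in> carrier_vec m. 0 \<le> Re ((A *\<^sub>v v) \<bullet>c v)) \<longleftrightarrow>
      (\<forall>v. 0 \<le> Re (\<Sum>i<m. \<Sum>j<m. cnj (v i) * v j * A $$ (i, j)))" (is "?L \<longleftrightarrow> ?R")
  proof
    assume ?L
    then show ?R
      by (simp only: mat_quadratic_form[OF True, symmetric]) simp
  next
    assume R: ?R
    show ?L
    proof
      fix v :: "complex vec" assume "v \<in> carrier_vec m"
      then have "v = vec m (($) v)" by auto
      then show "0 \<le> Re ((A *\<^sub>v v) \<bullet>c v)"
        using R mat_quadratic_form[OF True] by metis
    qed
  qed
  ultimately show ?thesis using True by (simp add: psd_def)
qed (simp add: psd_def)

lemma psd_smultD:
  assumes "psd m (complex_of_real c \<cdot>\<^sub>m M)" "0 < c"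
  shows "psd m M"
proof -
  have M: "M \<in> carrier_mat m m"
    using assms(1) unfolding psd_def carrier_mat_def by simp
  have scale: "(\<Sum>i<m. \<Sum>j<m. cnj (v i) * v j * (complex_of_real c \<cdot>\<^sub>m M) $$ (i, j))
    = complex_of_real c * (\<Sum>i<m. \<Sum>j<m. cnj (v i) * v j * M $$ (i, j))" for v
    using M by (auto simp: sum_distrib_left ac_simps intro!: sum.cong)
  have "0 \<le> Re (\<Sum>i<m. \<Sum>j<m. cnj (v i) * v j * M $$ (i, j))" for v
  proof -
    have "0 \<le> Re (complex_of_real c * (\<Sum>i<m. \<Sum>j<m. cnj (v i) * v j * M $$ (i, j)))"
      using assms(1) unfolding psd_iff scale by blast
    then show ?thesis
      using assms(2) unfolding times_complex.sel Re_complex_of_real Im_complex_of_real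
      by (simp only: mult_zero_left diff_zero zero_le_mult_iff) linarith
  qed
  moreover have "cnj (M $$ (j, i)) = M $$ (i, j)" if "i < m" "j < m" for i j
    using assms M that by (auto simp: psd_iff)
  ultimately show ?thesis unfolding psd_iff using M by blast
qed

lemma GPE_iff:
  "P \<in> GPE m \<longleftrightarrow> P \<in> carrier_mat m m \<and>
     (\<forall>i<m. \<forall>j<m. \<forall>s. cnj (poly (P $$ (j, i)) (- cnj s)) = poly (P $$ (i, j)) s) \<and>
     (AE t in lborel. psd m (eval_mat P (\<i> * complex_of_real t)))"
proof (cases "P \<in> carrier_mat m m")
  case True
  have "sharp (eval_mat P) s = eval_mat P s \<longleftrightarrow>
      (\<forall>i<m. \<forall>j<m. cnj (poly (P $$ (j, i)) (- cnj s)) = poly (P $$ (i, j)) s)" for s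
    using True by (subst mat_eq_iff) (auto simp: sharp_def eval_mat_def index_mat_adjoint)
  then show ?thesis using True by (auto simp: GPE_def)
qed (simp add: GPE_def)

text \<open>Swapping the two summation indices turns Hermitian symmetry into the reflection
  symmetry. Nonnegativity for almost all \<open>t\<close> extends to all \<open>t\<close> because it
  defines a closed set.\<close>

lemma even_nonneg_qform:
  assumes "P \<in> GPE m"
  shows "even_nonneg (qform m P v)"
proof -
  from assms have P: "P \<in> carrier_mat m m"
    and herm: "\<And>i j s. i < m \<Longrightarrow> j < m \<Longrightarrow> cnj (poly (P $$ (j, i)) (- cnj s)) = poly (P $$ (i, j)) s"
    and ae: "AE t in lborel. psd m (eval_mat P (\<i> * complex_of_real t))"
    by (auto simp: GPE_iff)
  have "poly (qform m P v) (- cnj s) = cnj (poly (qform m P v) s)" for s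
  proof -
    have "cnj (poly (qform m P v) (- cnj s))
      = (\<Sum>i<m. \<Sum>j<m. v i * cnj (v j) * cnj (poly (P $$ (i, j)) (- cnj s)))"
      by (simp add: qform_def poly_sum)
    also have "\<dots> = (\<Sum>i<m. \<Sum>j<m. v i * cnj (v j) * poly (P $$ (j, i)) s)"
      by (intro sum.cong refl) (simp only: herm lessThan_iff)
    also have "\<dots> = (\<Sum>j<m. \<Sum>i<m. v i * cnj (v j) * poly (P $$ (j, i)) s)"
      by (rule sum.swap)
    also have "\<dots> = poly (qform m P v) s"
      by (simp add: qform_def poly_sum ac_simps)
    finally show ?thesis by (metis complex_cnj_cnj)
  qed
  moreover have "0 \<le> Re (poly (qform m P v) (\<i> * complex_of_real t))" for t
  proof -
    have "closed {t. 0 \<le> Re (poly (qform m P v) (\<i> * complex_of_real t))}"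
      by (intro closed_Collect_le continuous_intros)
    moreover have "AE t in lborel. t \<in> {t. 0 \<le> Re (poly (qform m P v) (\<i> * complex_of_real t))}"
      using ae by eventually_elim (simp add: poly_qform[OF P] psd_def)
    ultimately have "t \<in> {t. 0 \<le> Re (poly (qform m P v) (\<i> * complex_of_real t))}"
      using mem_closed_if_AE_lebesgue AE_completion by blast
    then show ?thesis by simp
  qed
  ultimately show ?thesis by (simp add: even_nonneg_def)
qed

lemma corner_mat_in_GPE:
  assumes "even_nonneg g"
  shows "corner_mat m g \<in> GPE m"
proof -
  have g: "poly g (- cnj s) = cnj (poly g s)" "0 \<le> Re (poly g (\<i> * complex_of_real t))" for s t
    using assms by (auto simp: even_nonneg_def)
  have axis: "cnj (poly g (\<i> * complex_of_real t)) = poly g (\<i> * complex_of_real t)" for t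
    using g(1)[of "\<i> * complex_of_real t"] by simp
  have "psd m (eval_mat (corner_mat m g) (\<i> * complex_of_real t))" for t
  proof -
    have "0 \<le> Re (\<Sum>i<m. \<Sum>j<m. cnj (v i) * v j * eval_mat (corner_mat m g) (\<i> * complex_of_real t) $$ (i, j))"
      for v :: "nat \<Rightarrow> complex"
    proof (cases "m = 0")
      \<comment> \<open>Only the entry \<open>(0, 0)\<close> survives, so the form is the squared
        modulus of \<open>v 0\<close> times the value of \<open>g\<close>.\<close>
      case False
      have "(\<Sum>i<m. \<Sum>j<m. cnj (v i) * v j * eval_mat (corner_mat m g) (\<i> * complex_of_real t) $$ (i, j))
        = (\<Sum>i<m. \<Sum>j<m. if j = 0 then if i = 0 then cnj (v 0) * v 0 * poly g (\<i> * complex_of_real t) else 0 else 0)"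
        by (intro sum.cong refl) (auto simp: eval_mat_def corner_mat_def)
      also have "\<dots> = complex_of_real ((cmod (v 0))\<^sup>2) * poly g (\<i> * complex_of_real t)"
        using False unfolding complex_norm_square by (simp add: mult.commute)
      finally show ?thesis
        using g(2)[of t] by simp
    qed simp
    then show ?thesis
      using axis[of t] by (auto simp: psd_iff eval_mat_def corner_mat_def)
  qed
  then show ?thesis
    using g(1) by (auto simp: GPE_iff corner_mat_def)
qed

section \<open>The product over a reduced set\<close>

lemma poly_prod_zero_pair_imaginary:
  "poly (\<Prod>j\<in>J. zero_pair (x j)) (\<i> * complex_of_real t)
     = complex_of_real (\<Prod>j\<in>J. (cmod (x j - \<i> * complex_of_real t))\<^sup>2)"
  by (simp add: poly_prod poly_zero_pair_imaginary)

lemma even_nonneg_prod_zero_pair: "even_nonneg (\<Prod>j\<in>J. zero_pair (x j))"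
  unfolding even_nonneg_def poly_prod_zero_pair_imaginary Re_complex_of_real
  by (simp add: poly_prod poly_zero_pair_reflect prod_nonneg)

text \<open>By maximality, a point outside the reduced set cannot be adjoined to it, so it equals
  some \<open>x j\<close> or its reflection \<open>- cnj (x j)\<close>; both are zeros of
  \<open>zero_pair (x j)\<close>.\<close>

lemma reduced_indices_root:
  assumes red: "reduced_indices x p {1..n}" and k: "k \<in> {1..p}"
  shows "poly (\<Prod>j=1..n. zero_pair (x j)) (x k) = 0"
proof -
  have "\<exists>j\<in>{1..n}. x j = x k \<or> x j + cnj (x k) = 0"
  proof (cases "k \<in> {1..n}")
    case True
    then show ?thesis by blast
  next
    case False
    have nd: "nondegenerate x {1..n}"
      using red by (simp add: reduced_indices_def)
    have "\<not> nondegenerate x (insert k {1..n})"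
      using red k False unfolding reduced_indices_def by blast
    then obtain i j where ij: "i \<in> insert k {1..n}" "j \<in> insert k {1..n}" "i < j"
        "x i - x j = 0 \<or> x i + cnj (x j) = 0"
      unfolding nondegenerate_def by blast
    \<comment> \<open>The offending pair involves \<open>k\<close>, and \<open>k > n\<close> makes
      \<open>k\<close> the larger index.\<close>
    have "j = k"
      using ij nd False k by (auto simp: nondegenerate_def)
    then show ?thesis using ij by auto
  qed
  then obtain j where "j \<in> {1..n}" "x j = x k \<or> x j + cnj (x k) = 0" by blast
  moreover have "x j + cnj (x k) = 0 \<longleftrightarrow> cnj (x j) + x k = 0"
    by (metis complex_cnj_add complex_cnj_cnj complex_cnj_zero_iff)
  ultimately have "j \<in> {1..n}" "poly (zero_pair (x j)) (x k) = 0"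
    by (auto simp: poly_zero_pair)
  then show ?thesis by (auto simp: poly_prod)
qed

text \<open>Each quadratic form vanishes wherever \<open>P\<close> does, so scalar divisibility
  applies to all of them, and polarization passes it on to the entries.\<close>

lemma prod_zero_pair_dvd_entry:
  assumes P: "P \<in> GPE m" and nd: "nondegenerate x {1..n}"
    and zero: "\<And>k. k \<in> {1..n} \<Longrightarrow> eval_mat P (x k) = 0\<^sub>m m m" and "i < m" "j < m"
  shows "(\<Prod>j=1..n. zero_pair (x j)) dvd P $$ (i, j)"
proof (rule polarization_dvd[OF _ assms(4,5)])
  fix v
  have carrier: "P \<in> carrier_mat m m"
    using P by (simp add: GPE_def)
  have "poly (qform m P v) (x k) = 0" if "k \<in> {1..n}" for k
    unfolding poly_qform[OF carrier] zero[OF that] by (subst mat_quadratic_form) auto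
  then show "(\<Prod>j=1..n. zero_pair (x j)) dvd qform m P v"
    using even_nonneg_dvd[OF even_nonneg_qform[OF P] nd] by (metis dvd_triv_left)
qed

section \<open>Comparison of a minimal solution with the rank one solution\<close>

theorem proposition6p1:
  fixes m p n :: nat
    and x :: "nat \<Rightarrow> complex"
    and \<Psi> :: "complex poly mat"
  assumes "inj_on x {1..p}"
    and "reduced_indices x p {1..n}"
    and "\<Psi> \<in> nonzero_solutions m x p"
    and "\<forall>\<Phi> \<in> nonzero_solutions m x p. mcmillan_degree m \<Psi> \<le> mcmillan_degree m \<Phi>"
  shows "\<exists>M. psd m M \<and>
    (\<forall>s. eval_mat \<Psi> s =
           ((\<Prod>j=1..n. x j - s) \<cdot>\<^sub>m M) * ((\<Prod>j=1..n. cnj (x j) + s) \<cdot>\<^sub>m 1\<^sub>m m) \<and>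
         eval_mat \<Psi> s = (\<Prod>j=1..n. (x j - s) * (cnj (x j) + s)) \<cdot>\<^sub>m M)"
proof -
  define g where "g = (\<Prod>j=1..n. zero_pair (x j))"
  have GPE: "\<Psi> \<in> GPE m" and nz: "\<Psi> \<noteq> 0\<^sub>m m m"
    and zero: "\<And>k. k \<in> {1..p} \<Longrightarrow> eval_mat \<Psi> (x k) = 0\<^sub>m m m"
    using assms(3) by (auto simp: nonzero_solutions_def)
  have carrier: "\<Psi> \<in> carrier_mat m m"
    using GPE by (simp add: GPE_def)
  have red: "{1..n} \<subseteq> {1..p}" "nondegenerate x {1..n}"
    using assms(2) by (auto simp: reduced_indices_def)
  have g_nz: "g \<noteq> 0"
    by (simp add: g_def zero_pair_nonzero)
  \<comment> \<open>For \<open>m = 0\<close> every matrix in the carrier is the zero matrix.\<close>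
  have "0 < m"
    using nz carrier by (cases m) auto
  have "corner_mat m g \<in> nonzero_solutions m x p"
    unfolding nonzero_solutions_def
  proof (intro CollectI conjI ballI)
    show "corner_mat m g \<in> GPE m"
      unfolding g_def by (intro corner_mat_in_GPE even_nonneg_prod_zero_pair)
    have "corner_mat m g $$ (0, 0) \<noteq> 0\<^sub>m m m $$ (0, 0)"
      using \<open>0 < m\<close> g_nz by (simp add: corner_mat_def)
    then show "corner_mat m g \<noteq> 0\<^sub>m m m" by metis
    show "eval_mat (corner_mat m g) (x k) = 0\<^sub>m m m" if "k \<in> {1..p}" for k
      using reduced_indices_root[OF assms(2) that]
      by (intro eq_matI) (auto simp: eval_mat_def corner_mat_def g_def)
  qed
  then have "mcmillan_degree m \<Psi> \<le> degree g + 1"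
    using assms(4) mcmillan_degree_corner_mat[OF \<open>0 < m\<close>] le_trans by blast
  \<comment> \<open>The strict lower bound on the McMillan degree absorbs the \<open>+ 1\<close> of
    the upper bound.\<close>
  then have "poly_mat_degree \<Psi> \<le> degree g"
    using poly_mat_degree_less_mcmillan_degree[OF carrier nz] by linarith
  have "\<exists>c. \<Psi> $$ (i, j) = Polynomial.smult c g" if ij: "i < m" "j < m" for i j
  proof -
    have "g dvd \<Psi> $$ (i, j)"
      unfolding g_def using GPE red zero ij by (intro prod_zero_pair_dvd_entry) auto
    then obtain h where h: "\<Psi> $$ (i, j) = g * h" by blast
    have "degree (g * h) \<le> degree g"
      using degree_le_poly_mat_degree[OF carrier ij] h \<open>poly_mat_degree \<Psi> \<le> degree g\<close> by simp
    then have "degree h = 0"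
      using g_nz by (cases "h = 0") (auto simp: degree_mult_eq)
    then obtain c where "h = [:c:]"
      by (metis degree_eq_zeroE)
    then show ?thesis using h by auto
  qed
  then obtain C where C: "\<And>i j. i < m \<Longrightarrow> j < m \<Longrightarrow> \<Psi> $$ (i, j) = Polynomial.smult (C i j) g"
    by metis
  define M where "M = mat m m (\<lambda>(i, j). C i j)"
  have eval: "eval_mat \<Psi> s = poly g s \<cdot>\<^sub>m M" for s
    using carrier by (intro eq_matI) (auto simp: eval_mat_def M_def C)
  have "psd m M"
  proof -
    \<comment> \<open>Almost every \<open>t\<close> avoids the finitely many zeros of
      \<open>g\<close> and has \<open>\<Psi>\<close> positive semidefinite there; at such a point
      the positive value of \<open>g\<close> can be divided out.\<close>
    have "finite ((\<lambda>t. \<i> * complex_of_real t) -` {s. poly g s = 0})"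
      by (rule finite_vimageI[OF poly_roots_finite[OF g_nz]]) (auto simp: inj_on_def)
    then have "AE t in lborel. poly g (\<i> * complex_of_real t) \<noteq> 0"
      by (intro AE_I'[OF finite_imp_null_set_lborel]) auto
    moreover have "AE t in lborel. psd m (eval_mat \<Psi> (\<i> * complex_of_real t))"
      using GPE by (simp add: GPE_def)
    ultimately have "AE t::real in lborel. psd m M"
    proof eventually_elim
      case (elim t)
      let ?c = "\<Prod>j=1..n. (cmod (x j - \<i> * complex_of_real t))\<^sup>2"
      have c: "poly g (\<i> * complex_of_real t) = complex_of_real ?c"
        unfolding g_def by (rule poly_prod_zero_pair_imaginary)
      then have "?c \<noteq> 0" using elim(1) by (metis of_real_0)
      then have "0 < ?c" by (simp add: order_less_le prod_nonneg)
      then show ?case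
        using elim(2) unfolding eval c by (rule psd_smultD[rotated])
    qed
    \<comment> \<open>The statement no longer depends on \<open>t\<close>, and \<open>lborel\<close>
      is not the null measure, so holding almost everywhere means holding.\<close>
    then show ?thesis by (simp add: eventually_const ae_filter_eq_bot_iff)
  qed
  moreover have "poly g s = (\<Prod>j=1..n. (x j - s) * (cnj (x j) + s))" for s
    by (simp add: g_def poly_prod poly_zero_pair)
  moreover have "(\<Prod>j=1..n. (x j - s) * (cnj (x j) + s)) \<cdot>\<^sub>m M
      = ((\<Prod>j=1..n. x j - s) \<cdot>\<^sub>m M) * ((\<Prod>j=1..n. cnj (x j) + s) \<cdot>\<^sub>m 1\<^sub>m m)" for s
  proof -
    have "M \<in> carrier_mat m m" by (simp add: M_def)
    then have "(a \<cdot>\<^sub>m M) * (b \<cdot>\<^sub>m 1\<^sub>m m) = (a * b) \<cdot>\<^sub>m M" for a b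
      by (intro eq_matI) (simp_all add: mult_smult_distrib[of _ m m _ m])
    then show ?thesis by (simp add: prod.distrib)
  qed
  ultimately show ?thesis
    by (intro exI[of _ M]) (simp only: eval simp_thms)
qed

end
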